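(* Let $\Omega\subset\mathbb{R}^n$ be a domain, $T>0$, $f:\mathbb{R}\to\mathbb{R}$ a function, and let $u\in C^2_{x,t}(\Omega\times[0,T))$ be a classical solution of $\partial_tu=\Delta u-f(u)$ in $\Omega\times[0,T)$. Let $\phi:=\log(1/|\nabla u|)$. Then in $\{|\nabla u|\ne0\}$ the normal velocity of level surfaces $v:=-\frac{\partial_tu}{|\nabla u|}$ satisfies $$v=-H+\partial_\nu\phi+\frac{f(u)}{|\nabla u|}.$$ Thus each level surface evolves as a forced mean curvature flow.
   Context: $\nabla,\nabla^2$ are spatial derivatives. Where $\nabla u\neq0$: $\nu=\nabla u/|\nabla u|$ is the unit normal of the level surfaces of $u(\cdot,t)$, $P=I-\nu\otimes\nu$, $\mathbf{A}=P\frac{\nabla^2u}{|\nabla u|}P$ is their second fundamental form, $H=\mathrm{tr}(\mathbf{A})$ their mean curvature, and $\partial_\nu\phi=\nabla\phi\cdot\nu$. *)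

theory Defs
  imports "HOL-Analysis.Analysis"
begin

text \<open>
  Derivatives are taken relative to \<open>S\<close>, so that for \<open>S = \<Omega> \<times> [0,T)\<close> they are one-sided in time
  at \<open>t = 0\<close>. Continuity of \<open>D\<close> is implied by its differentiability.
\<close>
definition C2_on :: "('a::real_normed_vector \<Rightarrow> 'b::real_normed_vector) \<Rightarrow> 'a set \<Rightarrow> bool" where
  "C2_on g S \<longleftrightarrow>
    (\<exists>(D :: 'a \<Rightarrow> 'a \<Rightarrow>\<^sub>L 'b) (D2 :: 'a \<Rightarrow> 'a \<Rightarrow>\<^sub>L ('a \<Rightarrow>\<^sub>L 'b)).
      (\<forall>z\<in>S. (g has_derivative blinfun_apply (D z)) (at z within S)) \<and>
      (\<forall>z\<in>S. (D has_derivative blinfun_apply (D2 z)) (at z within S)) \<and>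
      continuous_on S D2)"

subsection \<open>Spatial derivatives and the geometry of the level surfaces of a function\<close>

definition grad :: "('a::real_inner \<Rightarrow> real) \<Rightarrow> 'a \<Rightarrow> 'a" where
  "grad g x = (THE d. GDERIV g x :> d)"

definition hessian :: "(real^'n \<Rightarrow> real) \<Rightarrow> real^'n \<Rightarrow> real^'n^'n" where
  "hessian g x = jacobian (grad g) (at x)"

definition laplacian :: "(real^'n \<Rightarrow> real) \<Rightarrow> real^'n \<Rightarrow> real" where
  "laplacian g x = trace (hessian g x)"

definition outer_product :: "real^'n \<Rightarrow> real^'n \<Rightarrow> real^'n^'n" where
  "outer_product a b = (\<chi> i j. a $ i * b $ j)"

definition unit_normal :: "(real^'n \<Rightarrow> real) \<Rightarrow> real^'n \<Rightarrow> real^'n" where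
  "unit_normal g x = grad g x /\<^sub>R norm (grad g x)"

definition tangent_proj :: "(real^'n \<Rightarrow> real) \<Rightarrow> real^'n \<Rightarrow> real^'n^'n" where
  "tangent_proj g x = mat 1 - outer_product (unit_normal g x) (unit_normal g x)"

definition second_fundamental_form :: "(real^'n \<Rightarrow> real) \<Rightarrow> real^'n \<Rightarrow> real^'n^'n" where
  "second_fundamental_form g x =
    tangent_proj g x ** (hessian g x /\<^sub>R norm (grad g x)) ** tangent_proj g x"

definition mean_curvature :: "(real^'n \<Rightarrow> real) \<Rightarrow> real^'n \<Rightarrow> real" where
  "mean_curvature g x = trace (second_fundamental_form g x)"

text \<open>The derivative of \<open>\<phi>\<close> in the direction of the normal to the level surfaces of \<open>g\<close>.\<close>
definition normal_deriv :: "(real^'n \<Rightarrow> real) \<Rightarrow> (real^'n \<Rightarrow> real) \<Rightarrow> real^'n \<Rightarrow> real" where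
  "normal_deriv g \<phi> x = grad \<phi> x \<bullet> unit_normal g x"

text \<open>Only used where the gradient does not vanish; elsewhere \<open>ln (1 / 0) = 0\<close> is a dummy value.\<close>
definition log_inv_grad :: "(real^'n \<Rightarrow> real) \<Rightarrow> real^'n \<Rightarrow> real" where
  "log_inv_grad g x = ln (1 / norm (grad g x))"

subsection \<open>Time-dependent functions on \<open>\<Omega> \<times> [0,T)\<close>\<close>

definition time_deriv :: "real \<Rightarrow> ('a \<Rightarrow> real \<Rightarrow> real) \<Rightarrow> 'a \<Rightarrow> real \<Rightarrow> real" where
  "time_deriv T u x t = vector_derivative (\<lambda>s. u x s) (at t within {0..<T})"

definition classical_solution ::
    "(real^'n) set \<Rightarrow> real \<Rightarrow> (real \<Rightarrow> real) \<Rightarrow> (real^'n \<Rightarrow> real \<Rightarrow> real) \<Rightarrow> bool" where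
  "classical_solution \<Omega> T f u \<longleftrightarrow>
    C2_on (\<lambda>(x, t). u x t) (\<Omega> \<times> {0..<T}) \<and>
    (\<forall>x\<in>\<Omega>. \<forall>t\<in>{0..<T}. time_deriv T u x t = laplacian (\<lambda>y. u y t) x - f (u x t))"

definition level_velocity :: "real \<Rightarrow> (real^'n \<Rightarrow> real \<Rightarrow> real) \<Rightarrow> real^'n \<Rightarrow> real \<Rightarrow> real" where
  "level_velocity T u x t = - time_deriv T u x t / norm (grad (\<lambda>y. u y t) x)"

text \<open>The part of the level set of height \<open>c\<close> where the gradient does not vanish.\<close>
definition level_surface ::
    "(real^'n) set \<Rightarrow> (real^'n \<Rightarrow> real \<Rightarrow> real) \<Rightarrow> real \<Rightarrow> real \<Rightarrow> (real^'n) set" where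
  "level_surface \<Omega> u c t = {x\<in>\<Omega>. u x t = c \<and> grad (\<lambda>y. u y t) x \<noteq> 0}"

subsection \<open>Moving surfaces\<close>

text \<open>
  \<open>\<gamma>\<close> is a trajectory through \<open>x\<close> at time \<open>t\<close>, with velocity \<open>w\<close>, that stays on the moving
  surface \<open>\<Gamma>\<close> at all times of \<open>J\<close> near \<open>t\<close>.
\<close>
definition trajectory_on ::
    "real set \<Rightarrow> (real \<Rightarrow> 'a set) \<Rightarrow> real \<Rightarrow> 'a \<Rightarrow> (real \<Rightarrow> 'a) \<Rightarrow> 'a::real_normed_vector \<Rightarrow> bool" where
  "trajectory_on J \<Gamma> t x \<gamma> w \<longleftrightarrow>
    \<gamma> t = x \<and> (\<forall>\<^sub>F s in at t within J. \<gamma> s \<in> \<Gamma> s) \<and>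
    (\<gamma> has_vector_derivative w) (at t within J)"

text \<open>
  The normal velocity \<open>V\<close> in direction \<open>N\<close> is the normal component common to the velocities of all
  trajectories; the first conjunct excludes the vacuous case.
\<close>
definition has_normal_velocity ::
    "real set \<Rightarrow> (real \<Rightarrow> 'a::real_inner set) \<Rightarrow> real \<Rightarrow> 'a \<Rightarrow> 'a \<Rightarrow> real \<Rightarrow> bool" where
  "has_normal_velocity J \<Gamma> t x N V \<longleftrightarrow>
    (\<exists>\<gamma> w. trajectory_on J \<Gamma> t x \<gamma> w) \<and>
    (\<forall>\<gamma> w. trajectory_on J \<Gamma> t x \<gamma> w \<longrightarrow> w \<bullet> N = V)"

text \<open>
  \<open>N\<close> and \<open>H\<close> are the unit normal and the mean curvature of \<open>\<Gamma>\<close>, with signs such that the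
  unforced flow has velocity \<open>- H\<close> in direction \<open>N\<close>; \<open>F\<close> is the forcing.
\<close>
definition forced_mean_curvature_flow ::
    "real set \<Rightarrow> (real \<Rightarrow> 'a::real_inner set) \<Rightarrow> ('a \<Rightarrow> real \<Rightarrow> 'a) \<Rightarrow>
      ('a \<Rightarrow> real \<Rightarrow> real) \<Rightarrow> ('a \<Rightarrow> real \<Rightarrow> real) \<Rightarrow> bool" where
  "forced_mean_curvature_flow J \<Gamma> N H F \<longleftrightarrow>
    (\<forall>t\<in>J. \<forall>x\<in>\<Gamma> t. has_normal_velocity J \<Gamma> t x (N x t) (- H x t + F x t))"

end

(*
  Since P is a projection, H = (tr D^2u - D^2u nu . nu) / |grad u|, and differentiating
  phi = -log |grad u| gives d_nu phi = - (D^2u nu . nu) / |grad u|. Hence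
  -H + d_nu phi = - Delta u / |grad u|, and the equation gives the formula for v.

  Differentiating u(gamma(s), s) = c shows that v is the normal component of the velocity of any
  trajectory gamma on a level surface; such a trajectory is found on the line through x in the
  direction of grad u.
*)
theory Submission imports Defs begin

section \<open>Gradient and curvature of the level surfaces of a fixed function\<close>

lemma gderiv_imp_grad:
  assumes "GDERIV g x :> d"
  shows "grad g x = d"
  unfolding grad_def
proof (rule the_equality)
  show "GDERIV g x :> d" by (rule assms)
next
  fix d' assume "GDERIV g x :> d'"
  then have "(\<lambda>h. h \<bullet> d') = (\<lambda>h. h \<bullet> d)"
    using assms unfolding gderiv_def by (rule has_derivative_unique)
  then show "d' = d"
    by (metis vector_eq_ldot)
qed

text \<open>Cyclicity of the trace brings the two factors \<open>P\<close> together, and idempotence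
  merges them.\<close>

lemma trace_sandwich_proj:
  fixes B P :: "real^'n^'n"
  assumes "P ** P = P"
  shows "trace (P ** B ** P) = trace (B ** P)"
  by (metis assms matrix_mul_assoc trace_mul_sym)

lemma matrix_diff_ldistrib:
  fixes A :: "'a::ring_1^'n^'m"
  shows "A ** (B - C) = A ** B - A ** C"
  by (simp add: matrix_matrix_mult_def vec_eq_iff right_diff_distrib sum_subtractf)

lemma matrix_diff_rdistrib:
  fixes A :: "'a::ring_1^'n^'m"
  shows "(A - B) ** C = A ** C - B ** C"
  by (simp add: matrix_matrix_mult_def vec_eq_iff left_diff_distrib sum_subtractf)

lemma trace_outer_product: "trace (outer_product a b) = a \<bullet> b"
  by (simp add: trace_def outer_product_def inner_vec_def)

lemma matrix_mul_outer_product: "B ** outer_product a b = outer_product (B *v a) b"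
  by (simp add: matrix_matrix_mult_def matrix_vector_mult_def outer_product_def vec_eq_iff
      sum_distrib_right mult.assoc)

lemma outer_product_mult_vec: "outer_product a b *v c = (b \<bullet> c) *\<^sub>R a"
  by (simp add: matrix_vector_mult_def outer_product_def vec_eq_iff inner_vec_def
      sum_distrib_right sum_distrib_left mult_ac)

lemma norm_unit_normal:
  assumes "grad g x \<noteq> 0"
  shows "norm (unit_normal g x) = 1"
  using assms by (simp add: unit_normal_def)

lemma mean_curvature_eq:
  fixes g :: "real^'n \<Rightarrow> real"
  assumes "grad g x \<noteq> 0"
  shows "mean_curvature g x =
    (laplacian g x - (hessian g x *v unit_normal g x) \<bullet> unit_normal g x) / norm (grad g x)"
proof -
  define \<nu> where "\<nu> = unit_normal g x"
  define Q where "Q = outer_product \<nu> \<nu>"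
  define B where "B = hessian g x /\<^sub>R norm (grad g x)"
  have "\<nu> \<bullet> \<nu> = 1"
    using norm_unit_normal[OF assms] by (simp add: \<nu>_def flip: norm_eq_1)
  then have "Q ** Q = Q"
    by (simp add: Q_def matrix_mul_outer_product outer_product_mult_vec)
  \<comment> \<open>Expanding the product gives \<open>mat 1 - Q - Q + Q ** Q\<close>, so the
    complement of an idempotent is idempotent, and only one of the two tangential projections
    survives under the trace.\<close>
  then have "(mat 1 - Q) ** (mat 1 - Q) = mat 1 - Q"
    by (simp add: matrix_diff_ldistrib matrix_diff_rdistrib)
  then have "mean_curvature g x = trace (B ** (mat 1 - Q))"
    by (simp add: mean_curvature_def second_fundamental_form_def tangent_proj_def
        trace_sandwich_proj flip: \<nu>_def Q_def B_def)
  also have "\<dots> = trace B - (B *v \<nu>) \<bullet> \<nu>"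
    by (simp add: matrix_diff_ldistrib trace_sub matrix_mul_outer_product trace_outer_product Q_def)
  also have "\<dots> = (laplacian g x - (hessian g x *v \<nu>) \<bullet> \<nu>) / norm (grad g x)"
    by (simp add: B_def laplacian_def trace_def scaleR_matrix_vector_assoc[symmetric]
        divide_inverse sum_distrib_left right_diff_distrib mult.commute)
  finally show ?thesis by (simp add: \<nu>_def)
qed

text \<open>Chain rule through \<open>grad g\<close>, the norm and \<open>ln (1 / r)\<close>: away
  from the origin the derivative of the norm is the inner product with the normalized vector, here
  the unit normal, and the last factor contributes \<open>- 1 / norm (grad g x)\<close>.\<close>

lemma normal_deriv_log_inv_grad:
  fixes g :: "real^'n \<Rightarrow> real"
  assumes diff: "grad g differentiable (at x)" and nz: "grad g x \<noteq> 0"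
  shows "normal_deriv g (log_inv_grad g) x =
    - ((hessian g x *v unit_normal g x) \<bullet> unit_normal g x) / norm (grad g x)"
proof -
  define A where "A = hessian g x"
  define \<nu> where "\<nu> = unit_normal g x"
  define N where "N = norm (grad g x)"
  have N: "N > 0" and grad: "grad g x = N *\<^sub>R \<nu>"
    using nz by (simp_all add: N_def \<nu>_def unit_normal_def)
  have D: "(grad g has_derivative (\<lambda>h. A *v h)) (at x)"
    using diff unfolding A_def hessian_def by (simp add: jacobian_works)
  have "((\<lambda>y. ln (1 / norm (grad g y))) has_derivative (\<lambda>h. - ((A *v h) \<bullet> \<nu>) / N)) (at x)"
  proof -
    have "((\<lambda>y. norm (grad g y)) has_derivative (\<lambda>h. (A *v h) \<bullet> \<nu>)) (at x)"
      using has_derivative_compose[OF D has_derivative_norm[OF nz]]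
      by (simp add: sgn_div_norm \<nu>_def unit_normal_def inner_commute)
    moreover have "((\<lambda>r. ln (1 / r)) has_derivative (\<lambda>h. - h / N)) (at (norm (grad g x)))"
      using N by (auto intro!: derivative_eq_intros simp: N_def[symmetric] field_simps)
    ultimately show ?thesis
      by (rule has_derivative_compose)
  qed
  \<comment> \<open>To read off a gradient, the derivative must be an inner product of
    \<open>h\<close> with a fixed vector, so \<open>A\<close> moves to the other side as its
    transpose. Pairing that vector with \<nu> moves it back.\<close>
  moreover have "- ((A *v h) \<bullet> \<nu>) / N = h \<bullet> (- (transpose A *v \<nu>) /\<^sub>R N)" for h
    by (simp add: dot_lmul_matrix[symmetric] inner_commute divide_inverse)
  ultimately have "GDERIV (log_inv_grad g) x :> - (transpose A *v \<nu>) /\<^sub>R N"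
    by (simp add: gderiv_def log_inv_grad_def[abs_def])
  then have "normal_deriv g (log_inv_grad g) x = (- (transpose A *v \<nu>) /\<^sub>R N) \<bullet> \<nu>"
    by (simp add: normal_deriv_def gderiv_imp_grad \<nu>_def)
  also have "\<dots> = - ((A *v \<nu>) \<bullet> \<nu>) / N"
    by (simp add: dot_lmul_matrix[symmetric] inner_commute divide_inverse)
  finally show ?thesis by (simp add: A_def \<nu>_def N_def)
qed

section \<open>Trajectories on moving level sets\<close>

text \<open>A chain rule for outer functions differentiable only relative to a set \<open>U\<close>
  containing the image. It suits \<open>\<Omega> \<times> J\<close>, where time derivatives may be
  one-sided.\<close>

lemma has_derivative_compose_within:
  assumes "(f has_derivative f') (at x within S)" "(g has_derivative g') (at y within U)"
    and "f x = y" "f ` S \<subseteq> U"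
  shows "((\<lambda>x. g (f x)) has_derivative (\<lambda>h. g' (f' h))) (at x within S)"
  using assms by (blast intro: has_derivative_in_compose has_derivative_subset)

text \<open>
  No uniqueness or continuity of the implicit function is needed: the intermediate value theorem
  gives a root \<open>r s\<close> with \<open>\<bar>r s\<bar> \<le> K \<bar>s - t\<bar>\<close>, and every such choice is differentiable at \<open>t\<close>
  by the first order expansion of \<open>F\<close>.
\<close>
lemma exists_level_trajectory:
  fixes F :: "'a::real_inner \<times> real \<Rightarrow> real"
  assumes \<Omega>: "open \<Omega>" "x \<in> \<Omega>" and t: "t \<in> J"
    and cont: "continuous_on (\<Omega> \<times> J) F"
    and deriv: "(F has_derivative (\<lambda>(h, k). h \<bullet> g + k * \<tau>)) (at (x, t) within \<Omega> \<times> J)"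
    and g: "g \<noteq> 0"
  obtains \<gamma> w where "\<gamma> t = x"
    "\<forall>\<^sub>F s in at t within J. \<gamma> s \<in> \<Omega> \<and> F (\<gamma> s, s) = F (x, t)"
    "(\<gamma> has_vector_derivative w) (at t within J)"
proof -
  define q where "q = g \<bullet> g"
  \<comment> \<open>To first order \<open>F\<close> changes by
    \<open>r * q + (s - t) * \<tau>\<close> when \<open>x\<close> moves by
    \<open>r *\<^sub>R g\<close>. The quotient in \<open>K\<close> lets \<open>r * q\<close> balance
    the time term at the ends of the interval of radius \<open>K * \<bar>s - t\<bar>\<close>; the
    summand 1 leaves a margin \<open>q * \<bar>s - t\<bar>\<close> for the remainder.\<close>
  define K where "K = \<bar>\<tau>\<bar> / q + 1"
  define M where "M = K * norm g + 1"
  define R where "R s r \<longleftrightarrow> \<bar>r\<bar> \<le> K * \<bar>s - t\<bar> \<and> x + r *\<^sub>R g \<in> \<Omega> \<and> F (x + r *\<^sub>R g, s) = F (x, t)" for s r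
  have q: "q > 0" using g by (simp add: q_def)
  have K: "K > 0" using q by (simp add: K_def add_nonneg_pos)
  have M: "M \<ge> 1" using K by (simp add: M_def)
  have size: "norm (r *\<^sub>R g) \<le> M * \<bar>s - t\<bar>" "norm ((x + r *\<^sub>R g, s) - (x, t)) \<le> M * \<bar>s - t\<bar>"
    if "\<bar>r\<bar> \<le> K * \<bar>s - t\<bar>" for r s
  proof -
    have *: "norm (r *\<^sub>R g) \<le> K * \<bar>s - t\<bar> * norm g"
      using that by (simp add: mult_right_mono)
    then show "norm (r *\<^sub>R g) \<le> M * \<bar>s - t\<bar>"
      by (simp add: M_def algebra_simps)
    have "norm (r *\<^sub>R g, s - t) \<le> norm (r *\<^sub>R g) + norm (s - t)"
      by (rule norm_Pair_le)
    then show "norm ((x + r *\<^sub>R g, s) - (x, t)) \<le> M * \<bar>s - t\<bar>"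
      using * by (simp add: M_def algebra_simps)
  qed
  \<comment> \<open>In the cone \<open>\<bar>r\<bar> \<le> K * \<bar>s - t\<bar>\<close> the
    space-time increment is at most \<open>M * \<bar>s - t\<bar>\<close>, so differentiability with
    tolerance \<open>e / M\<close> yields an error linear in \<open>s - t\<close> alone, uniformly
    in \<open>r\<close>.\<close>
  have expansion: "\<exists>\<eta>>0. \<forall>s\<in>J. \<forall>r. \<bar>s - t\<bar> < \<eta> \<longrightarrow> \<bar>r\<bar> \<le> K * \<bar>s - t\<bar> \<longrightarrow>
      x + r *\<^sub>R g \<in> \<Omega> \<and> \<bar>F (x + r *\<^sub>R g, s) - F (x, t) - (r * q + (s - t) * \<tau>)\<bar> \<le> e * \<bar>s - t\<bar>"
    if e: "e > 0" for e
  proof -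
    obtain \<rho> where \<rho>: "\<rho> > 0" "ball x \<rho> \<subseteq> \<Omega>"
      using \<Omega> open_contains_ball by blast
    have "e / M > 0" using e M by simp
    then obtain d where d: "d > 0" and dF:
      "\<And>z. z \<in> \<Omega> \<times> J \<Longrightarrow> norm (z - (x, t)) < d \<Longrightarrow>
        norm (F z - F (x, t) - (\<lambda>(h, k). h \<bullet> g + k * \<tau>) (z - (x, t))) \<le> e / M * norm (z - (x, t))"
      using deriv unfolding has_derivative_within_alt by blast
    show ?thesis
    proof (intro exI[of _ "min d \<rho> / M"] conjI ballI allI impI)
      show "min d \<rho> / M > 0" using d \<rho> M by simp
    next
      fix s r assume s: "s \<in> J" "\<bar>s - t\<bar> < min d \<rho> / M" and r: "\<bar>r\<bar> \<le> K * \<bar>s - t\<bar>"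
      have small: "M * \<bar>s - t\<bar> < d" "M * \<bar>s - t\<bar> < \<rho>"
        using s M by (simp_all add: field_simps)
      have "dist x (x + r *\<^sub>R g) < \<rho>"
        using size(1)[OF r] small by (simp add: dist_norm)
      then show in\<Omega>: "x + r *\<^sub>R g \<in> \<Omega>"
        using \<rho> by auto
      have "norm (F (x + r *\<^sub>R g, s) - F (x, t) - (r * q + (s - t) * \<tau>)) \<le> e / M * norm ((x + r *\<^sub>R g, s) - (x, t))"
        using dF[of "(x + r *\<^sub>R g, s)"] in\<Omega> s size(2)[OF r] small by (simp add: q_def)
      also have "\<dots> \<le> e / M * (M * \<bar>s - t\<bar>)"
        using e M size(2)[OF r] by (intro mult_left_mono) auto
      finally show "\<bar>F (x + r *\<^sub>R g, s) - F (x, t) - (r * q + (s - t) * \<tau>)\<bar> \<le> e * \<bar>s - t\<bar>"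
        using M by simp
    qed
  qed
  obtain \<eta> where \<eta>: "\<eta> > 0" and \<eta>F: "\<And>s r. s \<in> J \<Longrightarrow> \<bar>s - t\<bar> < \<eta> \<Longrightarrow> \<bar>r\<bar> \<le> K * \<bar>s - t\<bar> \<Longrightarrow>
      x + r *\<^sub>R g \<in> \<Omega> \<and> \<bar>F (x + r *\<^sub>R g, s) - F (x, t) - (r * q + (s - t) * \<tau>)\<bar> \<le> q * \<bar>s - t\<bar>"
    using expansion[OF q] by blast
  have root: "\<exists>r. R s r" if s: "s \<in> J" "\<bar>s - t\<bar> < \<eta>" for s
  proof -
    define h where "h = K * \<bar>s - t\<bar>"
    have h: "h \<ge> 0" using K by (simp add: h_def)
    have hq: "h * q = \<bar>(s - t) * \<tau>\<bar> + q * \<bar>s - t\<bar>"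
      using q by (simp add: h_def K_def abs_mult distrib_left distrib_right)
    \<comment> \<open>The tolerance \<open>q\<close> of the remainder is exactly the margin built
      into \<open>K\<close>, so \<open>F - F (x, t)\<close> has opposite weak signs at the two
      ends.\<close>
    have "F (x + (- h) *\<^sub>R g, s) \<le> F (x, t)"
      using \<eta>F[OF s, of "- h"] h hq abs_ge_self[of "(s - t) * \<tau>"]
      by (simp add: h_def[symmetric] abs_le_iff)
    moreover have "F (x, t) \<le> F (x + h *\<^sub>R g, s)"
      using \<eta>F[OF s, of h] h hq abs_ge_minus_self[of "(s - t) * \<tau>"]
      by (simp add: h_def[symmetric] abs_le_iff)
    moreover have "continuous_on {- h..h} (\<lambda>r. F (x + r *\<^sub>R g, s))"
    proof (rule continuous_on_compose2[OF cont])
      show "(\<lambda>r. (x + r *\<^sub>R g, s)) ` {- h..h} \<subseteq> \<Omega> \<times> J"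
        using \<eta>F[OF s] s by (auto simp: h_def abs_le_iff)
    qed (intro continuous_intros)
    ultimately obtain r where "- h \<le> r" "r \<le> h" "F (x + r *\<^sub>R g, s) = F (x, t)"
      using IVT'[of "\<lambda>r. F (x + r *\<^sub>R g, s)" "- h" "F (x, t)" h] h by auto
    then show ?thesis
      using \<eta>F[OF s, of r] by (auto simp: R_def h_def abs_le_iff)
  qed
  define r where "r s = (SOME r. R s r)" for s
  have r: "R s (r s)" if "s \<in> J" "\<bar>s - t\<bar> < \<eta>" for s
    unfolding r_def by (rule someI_ex[OF root[OF that]])
  \<comment> \<open>At \<open>s = t\<close> the interval for the root shrinks to a point, which
    fixes the choice there.\<close>
  have rt: "r t = 0"
    using r[of t] t \<eta> by (simp add: R_def)
  \<comment> \<open>The slope solves \<open>r * q + (s - t) * \<tau> = 0\<close>. As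
    \<open>F\<close> keeps its value at the roots, the expansion bounds the left side of this
    equation; the tolerance \<open>e * q\<close> becomes \<open>e\<close> after division by
    \<open>q\<close>.\<close>
  have "(r has_derivative (\<lambda>k. k * (- \<tau> / q))) (at t within J)"
    unfolding has_derivative_within_alt
  proof (intro conjI allI impI bounded_linear_mult_left)
    fix e :: real assume "e > 0"
    then have "e * q > 0" using q by simp
    from expansion[OF this] obtain \<delta> where \<delta>: "\<delta> > 0" and \<delta>F:
      "\<And>s r. s \<in> J \<Longrightarrow> \<bar>s - t\<bar> < \<delta> \<Longrightarrow> \<bar>r\<bar> \<le> K * \<bar>s - t\<bar> \<Longrightarrow>
        \<bar>F (x + r *\<^sub>R g, s) - F (x, t) - (r * q + (s - t) * \<tau>)\<bar> \<le> e * q * \<bar>s - t\<bar>"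
      by blast
    show "\<exists>d>0. \<forall>s\<in>J. norm (s - t) < d \<longrightarrow>
      norm (r s - r t - (s - t) * (- \<tau> / q)) \<le> e * norm (s - t)"
    proof (intro exI[of _ "min \<delta> \<eta>"] conjI ballI impI)
      fix s assume s: "s \<in> J" "norm (s - t) < min \<delta> \<eta>"
      then have "R s (r s)" using r by simp
      then have "\<bar>r s * q + (s - t) * \<tau>\<bar> \<le> e * q * \<bar>s - t\<bar>"
        using \<delta>F[of s "r s"] s by (simp add: R_def)
      moreover have "r s * q + (s - t) * \<tau> = q * (r s - r t - (s - t) * (- \<tau> / q))"
        using q by (simp add: rt field_simps)
      ultimately have "q * \<bar>r s - r t - (s - t) * (- \<tau> / q)\<bar> \<le> q * (e * \<bar>s - t\<bar>)"
        using q by (simp add: abs_mult mult_ac)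
      then show "norm (r s - r t - (s - t) * (- \<tau> / q)) \<le> e * norm (s - t)"
        using q by (simp del: times_divide_eq_right)
    qed (use \<delta> \<eta> in auto)
  qed
  then have "((\<lambda>s. x + r s *\<^sub>R g) has_derivative (\<lambda>k. k *\<^sub>R ((- \<tau> / q) *\<^sub>R g))) (at t within J)"
    by (auto intro!: derivative_eq_intros)
  moreover have "\<forall>\<^sub>F s in at t within J. x + r s *\<^sub>R g \<in> \<Omega> \<and> F (x + r s *\<^sub>R g, s) = F (x, t)"
    unfolding eventually_at using \<eta> r by (auto simp: R_def dist_real_def)
  ultimately show thesis
    by (intro that[of "\<lambda>s. x + r s *\<^sub>R g" "(- \<tau> / q) *\<^sub>R g"])
      (simp_all add: rt has_vector_derivative_def)
qed

text \<open>The chain rule along \<open>(\<gamma> s, s)\<close> gives the derivative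
  \<open>w \<bullet> g + \<tau>\<close> of a locally constant function. It must vanish because
  \<open>t\<close> is a limit point of \<open>J\<close>, so that derivatives within \<open>J\<close>
  are unique.\<close>

lemma level_trajectory_velocity:
  fixes F :: "'a::real_inner \<times> real \<Rightarrow> real"
  assumes t: "t \<in> J" and nontriv: "at t within J \<noteq> bot"
    and deriv: "(F has_derivative (\<lambda>(h, k). h \<bullet> g + k * \<tau>)) (at (\<gamma> t, t) within \<Omega> \<times> J)"
    and \<gamma>: "(\<gamma> has_vector_derivative w) (at t within J)"
    and level: "\<forall>\<^sub>F s in at t within J. \<gamma> s \<in> \<Omega> \<and> F (\<gamma> s, s) = F (\<gamma> t, t)"
    and \<Omega>: "\<gamma> t \<in> \<Omega>"
  shows "w \<bullet> g + \<tau> = 0"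
proof -
  obtain d where d: "d > 0"
    and "\<forall>s\<in>J. s \<noteq> t \<and> dist s t < d \<longrightarrow> \<gamma> s \<in> \<Omega> \<and> F (\<gamma> s, s) = F (\<gamma> t, t)"
    using level unfolding eventually_at by blast
  then have dF: "\<gamma> s \<in> \<Omega> \<and> F (\<gamma> s, s) = F (\<gamma> t, t)" if "s \<in> J" "dist s t < d" for s
    using that \<Omega> by (cases "s = t") simp_all
  \<comment> \<open>The trajectory is known to lie in \<Omega> only near \<open>t\<close>, while the
    chain rule needs the whole image inside \<open>\<Omega> \<times> J\<close>. Shrinking
    \<open>J\<close> to a ball leaves the filter at \<open>t\<close> unchanged.\<close>
  let ?J = "J \<inter> ball t d"
  have at_eq: "at t within J = at t within ?J"
    by (rule at_within_nhd[of t "ball t d"]) (use d in auto)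
  have "((\<lambda>s. (\<gamma> s, s)) has_derivative (\<lambda>k. (k *\<^sub>R w, k))) (at t within ?J)"
    using \<gamma> unfolding has_vector_derivative_def at_eq by (intro has_derivative_Pair has_derivative_ident)
  moreover have "(\<lambda>s. (\<gamma> s, s)) ` ?J \<subseteq> \<Omega> \<times> J"
    using dF by (auto simp: dist_commute)
  ultimately have "((\<lambda>s. F (\<gamma> s, s)) has_derivative
      (\<lambda>k. (\<lambda>(h, k). h \<bullet> g + k * \<tau>) (k *\<^sub>R w, k))) (at t within ?J)"
    by (intro has_derivative_compose_within[OF _ deriv]) simp_all
  then have "((\<lambda>s. F (\<gamma> s, s)) has_vector_derivative (w \<bullet> g + \<tau>)) (at t within ?J)"
    by (simp add: has_vector_derivative_def distrib_left)
  moreover have "((\<lambda>s. F (\<gamma> s, s)) has_vector_derivative 0) (at t within ?J)"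
  proof (rule has_vector_derivative_transform[of t ?J])
    show "F (\<gamma> s, s) = F (\<gamma> t, t)" if "s \<in> ?J" for s
      using dF[of s] that by (simp only: Int_iff mem_ball dist_commute)
  qed (use t d in simp_all)
  ultimately show ?thesis
    by (rule vector_derivative_unique_within[OF nontriv[unfolded at_eq]])
qed

section \<open>Spatial and temporal derivatives of a function on space-time\<close>

text \<open>The total derivative splits by linearity into its values on \<open>(h, 0)\<close> and
  \<open>(0, k)\<close>. The spatial part inherits differentiability because it is a finite
  combination of evaluations of \<open>D\<close> at fixed vectors.\<close>

lemma C2_on_gradient:
  fixes u :: "real^'n \<Rightarrow> real \<Rightarrow> real"
  assumes "C2_on (\<lambda>(x, t). u x t) (\<Omega> \<times> J)"
  obtains G \<tau> where
    "\<And>x t. x \<in> \<Omega> \<Longrightarrow> t \<in> J \<Longrightarrow>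
      ((\<lambda>(x, t). u x t) has_derivative (\<lambda>(h, k). h \<bullet> G (x, t) + k * \<tau> (x, t))) (at (x, t) within \<Omega> \<times> J)"
    "\<And>z. z \<in> \<Omega> \<times> J \<Longrightarrow> G differentiable (at z within \<Omega> \<times> J)"
proof -
  let ?F = "\<lambda>(x, t). u x t"
  obtain D :: "(real^'n) \<times> real \<Rightarrow> ((real^'n) \<times> real) \<Rightarrow>\<^sub>L real" and D2 where
    D: "\<And>z. z \<in> \<Omega> \<times> J \<Longrightarrow> (?F has_derivative blinfun_apply (D z)) (at z within \<Omega> \<times> J)" and
    D2: "\<And>z. z \<in> \<Omega> \<times> J \<Longrightarrow> (D has_derivative blinfun_apply (D2 z)) (at z within \<Omega> \<times> J)"
    using assms unfolding C2_on_def by blast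
  \<comment> \<open>The Riesz representative of the functional sending \<open>h\<close> to
    \<open>D z\<close> at \<open>(h, 0)\<close>, written in the orthonormal basis.\<close>
  define G where "G z = (\<Sum>b\<in>Basis. blinfun_apply (D z) (b, 0) *\<^sub>R b)" for z
  have split: "blinfun_apply (D z) = (\<lambda>(h, k). h \<bullet> G z + k * blinfun_apply (D z) (0, 1))" for z
  proof (intro ext, clarify)
    fix h :: "real^'n" and k :: real
    have "(h, 0) = (\<Sum>b\<in>Basis. (h \<bullet> b) *\<^sub>R (b, 0 :: real))"
      by (simp add: sum_prod euclidean_representation)
    then have "blinfun_apply (D z) (h, 0) = blinfun_apply (D z) (\<Sum>b\<in>Basis. (h \<bullet> b) *\<^sub>R (b, 0))"
      by (rule arg_cong)
    also have "\<dots> = h \<bullet> G z"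
      by (simp add: G_def blinfun.sum_right blinfun.scaleR_right inner_sum_right mult.commute
          del: scaleR_Pair)
    finally have "blinfun_apply (D z) (h, 0) = h \<bullet> G z" .
    moreover have "blinfun_apply (D z) ((h, 0) + k *\<^sub>R (0, 1))
        = blinfun_apply (D z) (h, 0) + k * blinfun_apply (D z) (0, 1)"
      by (simp only: blinfun.add_right blinfun.scaleR_right real_scaleR_def)
    ultimately show "blinfun_apply (D z) (h, k) = h \<bullet> G z + k * blinfun_apply (D z) (0, 1)"
      by simp
  qed
  have "G differentiable (at z within \<Omega> \<times> J)" if "z \<in> \<Omega> \<times> J" for z
  proof -
    have "((\<lambda>z. blinfun_apply (D z) v) has_derivative (\<lambda>h. blinfun_apply (blinfun_apply (D2 z) h) v))
        (at z within \<Omega> \<times> J)" for v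
      using bounded_linear.has_derivative[OF blinfun.bounded_linear_left D2[OF that]] .
    then show ?thesis
      unfolding G_def[abs_def]
      by (intro differentiable_sum ballI differentiable_scaleR differentiable_const finite_Basis)
        (auto simp: differentiable_def)
  qed
  with D split show thesis
    using that[of G "\<lambda>z. blinfun_apply (D z) (0, 1)"] by (metis SigmaI)
qed

text \<open>Compose with the embeddings of a space slice and a time slice. Openness of \<Omega>
  turns the spatial derivative into a full one, as \<open>grad\<close> requires; the temporal one
  stays relative to \<open>J\<close>, as in \<open>time_deriv\<close>.\<close>

lemma has_derivative_slice:
  assumes "(F has_derivative F') (at (x, t) within \<Omega> \<times> J)" "open \<Omega>" "x \<in> \<Omega>" "t \<in> J"
  shows "((\<lambda>y. F (y, t)) has_derivative (\<lambda>h. F' (h, 0))) (at x)"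
    and "((\<lambda>s. F (x, s)) has_derivative (\<lambda>k. F' (0, k))) (at t within J)"
proof -
  have "((\<lambda>y. F (y, t)) has_derivative (\<lambda>h. F' (h, 0))) (at x within \<Omega>)"
    by (rule has_derivative_compose_within[OF has_derivative_Pair[OF has_derivative_ident has_derivative_const] assms(1)])
      (use assms(4) in auto)
  then show "((\<lambda>y. F (y, t)) has_derivative (\<lambda>h. F' (h, 0))) (at x)"
    by (simp only: at_within_open[OF assms(3,2)])
  show "((\<lambda>s. F (x, s)) has_derivative (\<lambda>k. F' (0, k))) (at t within J)"
    by (rule has_derivative_compose_within[OF has_derivative_Pair[OF has_derivative_const has_derivative_ident] assms(1)])
      (use assms(3) in auto)
qed
lemma at_within_atLeastLessThan_neq_bot:
  fixes a b t :: real
  assumes "t \<in> {a..<b}"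
  shows "at t within {a..<b} \<noteq> bot"
  using assms by (simp add: trivial_limit_within)

section \<open>The velocity formula and the forced mean curvature flow\<close>

theorem proposition4p1:
  fixes \<Omega> :: "(real^'n) set" and T :: real and f :: "real \<Rightarrow> real"
    and u :: "real^'n \<Rightarrow> real \<Rightarrow> real"
  assumes "open \<Omega>" and "connected \<Omega>" and "\<Omega> \<noteq> {}"
    and "T > 0"
    and "classical_solution \<Omega> T f u"
  shows "(\<forall>x\<in>\<Omega>. \<forall>t\<in>{0..<T}. grad (\<lambda>y. u y t) x \<noteq> 0 \<longrightarrow>
      level_velocity T u x t =
        - mean_curvature (\<lambda>y. u y t) x
        + normal_deriv (\<lambda>y. u y t) (log_inv_grad (\<lambda>y. u y t)) x
        + f (u x t) / norm (grad (\<lambda>y. u y t) x)) \<and>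
    (\<forall>c. forced_mean_curvature_flow {0..<T} (level_surface \<Omega> u c)
      (\<lambda>x t. unit_normal (\<lambda>y. u y t) x)
      (\<lambda>x t. mean_curvature (\<lambda>y. u y t) x)
      (\<lambda>x t. normal_deriv (\<lambda>y. u y t) (log_inv_grad (\<lambda>y. u y t)) x
        + f (u x t) / norm (grad (\<lambda>y. u y t) x)))"
proof -
  let ?J = "{0..<T}"
  let ?F = "\<lambda>(x, t). u x t"
  have C2: "C2_on ?F (\<Omega> \<times> ?J)"
    and pde: "\<And>x t. x \<in> \<Omega> \<Longrightarrow> t \<in> ?J \<Longrightarrow>
      time_deriv T u x t = laplacian (\<lambda>y. u y t) x - f (u x t)"
    using assms(5) by (auto simp: classical_solution_def)
  obtain G \<tau> where
    F: "\<And>x t. x \<in> \<Omega> \<Longrightarrow> t \<in> ?J \<Longrightarrow>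
      (?F has_derivative (\<lambda>(h, k). h \<bullet> G (x, t) + k * \<tau> (x, t))) (at (x, t) within \<Omega> \<times> ?J)" and
    G: "\<And>z. z \<in> \<Omega> \<times> ?J \<Longrightarrow> G differentiable (at z within \<Omega> \<times> ?J)"
    using C2_on_gradient[OF C2] by blast
  have grad: "grad (\<lambda>y. u y t) x = G (x, t)" if "x \<in> \<Omega>" "t \<in> ?J" for x t
    using has_derivative_slice(1)[OF F \<open>open \<Omega>\<close>] that
    by (intro gderiv_imp_grad) (simp add: gderiv_def)
  have time: "time_deriv T u x t = \<tau> (x, t)" if "x \<in> \<Omega>" "t \<in> ?J" for x t
    using has_derivative_slice(2)[OF F \<open>open \<Omega>\<close>] that
    unfolding time_deriv_def
    by (intro vector_derivative_within at_within_atLeastLessThan_neq_bot)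
      (auto simp: has_vector_derivative_def)
  have grad_diff: "grad (\<lambda>y. u y t) differentiable (at x)" if x: "x \<in> \<Omega>" and t: "t \<in> ?J" for x t
  proof -
    obtain G' where "(G has_derivative G') (at (x, t) within \<Omega> \<times> ?J)"
      using G[of "(x, t)"] x t by (auto simp: differentiable_def)
    then have "((\<lambda>y. G (y, t)) has_derivative (\<lambda>h. G' (h, 0))) (at x)"
      using \<open>open \<Omega>\<close> x t by (rule has_derivative_slice)
    \<comment> \<open>The gradient is identified with \<open>G\<close> only on \<Omega>, and
      openness suffices to transfer the derivative at \<open>x\<close>.\<close>
    then have "(grad (\<lambda>y. u y t) has_derivative (\<lambda>h. G' (h, 0))) (at x)"
      by (rule has_derivative_transform_within_open[OF _ \<open>open \<Omega>\<close> x]) (use grad t in simp)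
    then show ?thesis by (auto simp: differentiable_def)
  qed
  \<comment> \<open>The normal second derivatives from the curvature and from the logarithm cancel,
    leaving the Laplacian and \<open>f\<close>. The parentheses group the forcing term as the flow
    definition expects it.\<close>
  have velocity: "level_velocity T u x t = - mean_curvature (\<lambda>y. u y t) x
        + (normal_deriv (\<lambda>y. u y t) (log_inv_grad (\<lambda>y. u y t)) x
        + f (u x t) / norm (grad (\<lambda>y. u y t) x))"
    if "x \<in> \<Omega>" "t \<in> ?J" "grad (\<lambda>y. u y t) x \<noteq> 0" for x t
    using that
    by (simp add: level_velocity_def pde mean_curvature_eq normal_deriv_log_inv_grad grad_diff
        field_simps)
  have normal_velocity: "has_normal_velocity ?J (level_surface \<Omega> u c) t x (unit_normal (\<lambda>y. u y t) x)
      (level_velocity T u x t)"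
    if t: "t \<in> ?J" and x: "x \<in> level_surface \<Omega> u c t" for c t x
  proof -
    let ?S = "level_surface \<Omega> u c"
    have x\<Omega>: "x \<in> \<Omega>" and c: "u x t = c" and nz: "G (x, t) \<noteq> 0"
      using x t by (auto simp: level_surface_def grad)
    have "trajectory_on ?J ?S t x \<gamma> w \<Longrightarrow>
        w \<bullet> unit_normal (\<lambda>y. u y t) x = level_velocity T u x t" for \<gamma> w
    proof -
      assume traj: "trajectory_on ?J ?S t x \<gamma> w"
      then have \<gamma>: "\<gamma> t = x" "(\<gamma> has_vector_derivative w) (at t within ?J)"
        and ev: "\<forall>\<^sub>F s in at t within ?J. \<gamma> s \<in> ?S s"
        by (auto simp: trajectory_on_def)
      have "\<forall>\<^sub>F s in at t within ?J. \<gamma> s \<in> \<Omega> \<and> ?F (\<gamma> s, s) = ?F (\<gamma> t, t)"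
        using ev by eventually_elim (simp add: level_surface_def \<gamma> c)
      then have "w \<bullet> G (x, t) = - \<tau> (x, t)"
        using level_trajectory_velocity[OF t at_within_atLeastLessThan_neq_bot[OF t] _ \<gamma>(2)]
          F[OF x\<Omega> t] x\<Omega> \<gamma>(1) by (simp add: eq_neg_iff_add_eq_0)
      \<comment> \<open>Dividing by the norm of the gradient turns
        \<open>w \<bullet> G (x, t)\<close> into the normal component of \<open>w\<close>, and
        \<open>- \<tau> (x, t)\<close> into the level velocity.\<close>
      then show ?thesis
        by (simp add: unit_normal_def level_velocity_def grad[OF x\<Omega> t] time[OF x\<Omega> t] divide_inverse)
    qed
    moreover have "\<exists>\<gamma> w. trajectory_on ?J ?S t x \<gamma> w"
    proof -
      have "continuous_on (\<Omega> \<times> ?J) ?F"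
        unfolding continuous_on_eq_continuous_within
        using F by (blast intro: has_derivative_continuous)
      then obtain \<gamma> w where \<gamma>: "\<gamma> t = x" "(\<gamma> has_vector_derivative w) (at t within ?J)"
        and level: "\<forall>\<^sub>F s in at t within ?J. \<gamma> s \<in> \<Omega> \<and> ?F (\<gamma> s, s) = ?F (x, t)"
        using exists_level_trajectory[OF \<open>open \<Omega>\<close> x\<Omega> t _ F[OF x\<Omega> t] nz] by blast
      have J: "\<forall>\<^sub>F s in at t within ?J. s \<in> ?J"
        by (simp add: eventually_at_filter)
      \<comment> \<open>The trajectory keeps the height \<open>c\<close>, but
        \<open>level_surface\<close> also demands a nonzero gradient. Continuity of \<open>G\<close>
        along the trajectory preserves this near \<open>t\<close>.\<close>
      have "((\<lambda>s. G (\<gamma> s, s)) \<longlongrightarrow> G (x, t)) (at t within ?J)"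
      proof (rule continuous_within_tendsto_compose[where f = G and x = "\<lambda>s. (\<gamma> s, s)"])
        show "continuous (at (x, t) within \<Omega> \<times> ?J) G"
          using G x\<Omega> t by (intro differentiable_imp_continuous_within) auto
        show "\<forall>\<^sub>F s in at t within ?J. (\<gamma> s, s) \<in> \<Omega> \<times> ?J"
          using level J by eventually_elim simp
        have "(\<gamma> \<longlongrightarrow> x) (at t within ?J)"
          using has_vector_derivative_continuous[OF \<gamma>(2)] by (simp add: continuous_within \<gamma>(1))
        then show "((\<lambda>s. (\<gamma> s, s)) \<longlongrightarrow> (x, t)) (at t within ?J)"
          by (intro tendsto_intros)
      qed
      then have "\<forall>\<^sub>F s in at t within ?J. G (\<gamma> s, s) \<noteq> 0"
        using nz by (rule tendsto_imp_eventually_ne)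
      then have "\<forall>\<^sub>F s in at t within ?J. \<gamma> s \<in> ?S s"
        using level J by eventually_elim (simp add: level_surface_def grad c)
      with \<gamma> show ?thesis by (auto simp: trajectory_on_def)
    qed
    ultimately show ?thesis by (auto simp: has_normal_velocity_def)
  qed
  have "forced_mean_curvature_flow ?J (level_surface \<Omega> u c)
      (\<lambda>x t. unit_normal (\<lambda>y. u y t) x)
      (\<lambda>x t. mean_curvature (\<lambda>y. u y t) x)
      (\<lambda>x t. normal_deriv (\<lambda>y. u y t) (log_inv_grad (\<lambda>y. u y t)) x
        + f (u x t) / norm (grad (\<lambda>y. u y t) x))" for c
    unfolding forced_mean_curvature_flow_def
  proof (intro ballI)
    fix t x assume t: "t \<in> ?J" and x: "x \<in> level_surface \<Omega> u c t"
    then have "x \<in> \<Omega>" "grad (\<lambda>y. u y t) x \<noteq> 0"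
      by (auto simp: level_surface_def)
    from normal_velocity[OF t x, unfolded velocity[OF this(1) t this(2)]]
    show "has_normal_velocity ?J (level_surface \<Omega> u c) t x (unit_normal (\<lambda>y. u y t) x)
      (- mean_curvature (\<lambda>y. u y t) x + (normal_deriv (\<lambda>y. u y t) (log_inv_grad (\<lambda>y. u y t)) x
        + f (u x t) / norm (grad (\<lambda>y. u y t) x)))" .
  qed
  with velocity show ?thesis
    unfolding add.assoc by blast
qed

end
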